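(* Let $p$ be a prime number, $k$ a natural number, and let $X:=\{0,\dots,p^k-1\}$ be an indecomposable cycle set of order $p^k$, having multipermutational level $n>1$ and cyclic permutation group $\mathcal{G}(X)=\langle t_1\rangle$, where $t_1:=(0\;1\;\dots\;p^k-1)$ and $\sigma_0=t_1$. Then for every $j\in\{1,\dots,n-1\}$ there exists a function $$f_j:\mathbb{Z}/|\sigma^j(X)|\mathbb{Z}\longrightarrow\{0,\dots,|\sigma^{j-1}(X)|/|\sigma^j(X)|-1\}$$ with $f_j(0)=0$, such that for every $b\in\{1,\dots,n-1\}$ the function $$\varphi_b:\{0,\dots,|\sigma^b(X)|-1\}\longrightarrow\{1,\dots,|\sigma^{b-1}(X)|-1\},\qquad i\mapsto 1+\sum_{m=b}^{n-1}|\sigma^m(X)|f_m(i)$$ is injective, and $$\sigma_i=t_1^{1+\sum_{m=1}^{n-1}|\sigma^m(X)|f_m(i)}$$ for every $i\in\{0,\dots,p^k-1\}$. Moreover, if for $i,j\in\{0,\dots,p^k-1\}$ we put $$K_{j,i}:=j+1+\sum_{m=2}^{n-1}|\sigma^m(X)|f_m(i),\qquad Q_{j,i}:=\sum_{m=1}^{n-1}|\sigma^m(X)|f_m(i)+\sum_{m=1}^{n-1}|\sigma^m(X)|f_m(K_{j,i}),$$ then $Q_{i,j}\equiv Q_{j,i}\pmod{p^k}$ for every $i,j\in\{0,\dots,p^k-1\}$.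
   Context: A cycle set is a non-empty set $X$ with a binary operation $\cdot$ such that every left multiplication $\sigma_x:X\to X,\ y\mapsto x\cdot y$ is bijective and $(x\cdot y)\cdot(x\cdot z)=(y\cdot x)\cdot(y\cdot z)$ for all $x,y,z\in X$. The permutation group $\mathcal{G}(X)$ is the subgroup of $Sym(X)$ generated by $\{\sigma_x\mid x\in X\}$. $X$ is indecomposable if there is no partition $\{Y,Z\}$ of $X$ into non-empty subsets with $\sigma_x(Y)\subseteq Y$ and $\sigma_x(Z)\subseteq Z$ for all $x\in X$ (equivalently, $\mathcal{G}(X)$ is transitive on $X$). For a non-degenerate cycle set (i.e. $x\mapsto x\cdot x$ is bijective; every finite cycle set is non-degenerate) the retraction is the cycle set $\sigma(X):=\{\sigma_x\mid x\in X\}$ with $\sigma_x\cdot\sigma_y:=\sigma_{x\cdot y}$; one puts $\sigma^0(X):=X$, $\sigma^m(X):=\sigma(\sigma^{m-1}(X))$ for $m\ge1$. $X$ is multipermutational of level $m$ if $m$ is the minimal non-negative integer with $|\sigma^m(X)|=1$. When an integer $l$ is given as argument to a function $f_m$ defined on $\mathbb{Z}/|\sigma^m(X)|\mathbb{Z}$, $f_m(l)$ means the value of $f_m$ at the class of $l$ modulo $|\sigma^m(X)|$. Empty sums are $0$. *)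

theory Defs
  imports
    "HOL-Algebra.Bij"
    "HOL-Algebra.Generated_Groups"
    "HOL-Computational_Algebra.Primes"
    "HOL-Number_Theory.Cong"
begin

record 'a cycle_struct = "'a partial_object" +
  dot :: "'a \<Rightarrow> 'a \<Rightarrow> 'a" (infixl \<open>\<cdot>\<index>\<close> 70)

text \<open>
  The maps $\sigma_x$ are restricted to the carrier (value \<^const>\<open>undefined\<close> outside), so that
  equality of left multiplications is equality as maps on the carrier, and so that they are elements
  of \<^term>\<open>carrier (BijGroup (carrier X))\<close>, which is $Sym(X)$.
\<close>

definition left_mult :: "'a cycle_struct \<Rightarrow> 'a \<Rightarrow> 'a \<Rightarrow> 'a" where
  "left_mult X x = (\<lambda>y\<in>carrier X. x \<cdot>\<^bsub>X\<^esub> y)"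

definition cycle_set :: "'a cycle_struct \<Rightarrow> bool" where
  "cycle_set X \<longleftrightarrow>
     carrier X \<noteq> {} \<and>
     (\<forall>x\<in>carrier X. bij_betw (left_mult X x) (carrier X) (carrier X)) \<and>
     (\<forall>x\<in>carrier X. \<forall>y\<in>carrier X. \<forall>z\<in>carrier X.
        (x \<cdot>\<^bsub>X\<^esub> y) \<cdot>\<^bsub>X\<^esub> (x \<cdot>\<^bsub>X\<^esub> z) = (y \<cdot>\<^bsub>X\<^esub> x) \<cdot>\<^bsub>X\<^esub> (y \<cdot>\<^bsub>X\<^esub> z))"

definition permutation_group :: "'a cycle_struct \<Rightarrow> ('a \<Rightarrow> 'a) set" where
  "permutation_group X = generate (BijGroup (carrier X)) (left_mult X ` carrier X)"

definition indecomposable :: "'a cycle_struct \<Rightarrow> bool" where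
  "indecomposable X \<longleftrightarrow>
     \<not> (\<exists>Y Z. Y \<noteq> {} \<and> Z \<noteq> {} \<and> Y \<union> Z = carrier X \<and> Y \<inter> Z = {} \<and>
          (\<forall>x\<in>carrier X. left_mult X x ` Y \<subseteq> Y \<and> left_mult X x ` Z \<subseteq> Z))"

text \<open>
  The retraction $\sigma(X) = \{\sigma_x \mid x \in X\}$ with $\sigma_x \cdot \sigma_y = \sigma_{x \cdot y}$.
  The elements $x$, $y$ are recovered from $\sigma_x$, $\sigma_y$ by choice; the lemma
  \<open>dot_retraction\<close> below shows that the choice does not matter.
\<close>

definition retraction :: "'a cycle_struct \<Rightarrow> ('a \<Rightarrow> 'a) cycle_struct" where
  "retraction X =
     \<lparr>carrier = left_mult X ` carrier X,
      dot = (\<lambda>s t. left_mult X (inv_into (carrier X) (left_mult X) s \<cdot>\<^bsub>X\<^esub>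
                                inv_into (carrier X) (left_mult X) t))\<rparr>"

definition transport :: "('a \<Rightarrow> 'b) \<Rightarrow> 'a cycle_struct \<Rightarrow> 'b cycle_struct" where
  "transport h Y =
     \<lparr>carrier = h ` carrier Y,
      dot = (\<lambda>a b. h (inv_into (carrier Y) h a \<cdot>\<^bsub>Y\<^esub> inv_into (carrier Y) h b))\<rparr>"

text \<open>
  The type of \<^term>\<open>retraction X\<close> differs from that of \<^term>\<open>X\<close>, so it cannot be iterated as it
  stands. We iterate its isomorphic copy in which each $\sigma_x$ is renamed to a chosen element
  $x'$ of \<^term>\<open>X\<close> with $\sigma_{x'} = \sigma_x$; the lemma \<open>retraction_copy_iso\<close> states the
  isomorphism.
\<close>

definition retraction_copy :: "'a cycle_struct \<Rightarrow> 'a cycle_struct" where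
  "retraction_copy X = transport (inv_into (carrier X) (left_mult X)) (retraction X)"

definition iterated_retraction :: "nat \<Rightarrow> 'a cycle_struct \<Rightarrow> 'a cycle_struct" where
  "iterated_retraction m X = (retraction_copy ^^ m) X"

definition retraction_order :: "'a cycle_struct \<Rightarrow> nat \<Rightarrow> nat" where
  "retraction_order X m = card (carrier (iterated_retraction m X))"

definition multipermutational_level :: "'a cycle_struct \<Rightarrow> nat \<Rightarrow> bool" where
  "multipermutational_level X m \<longleftrightarrow>
     retraction_order X m = 1 \<and> (\<forall>l<m. retraction_order X l \<noteq> 1)"

definition std_cycle :: "nat \<Rightarrow> nat \<Rightarrow> nat" where
  "std_cycle N = (\<lambda>i\<in>{0..N - 1}. (i + 1) mod N)"

lemma dot_retraction:
  assumes X: "cycle_set X" and x: "x \<in> carrier X" and y: "y \<in> carrier X"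
  shows "left_mult X x \<cdot>\<^bsub>retraction X\<^esub> left_mult X y = left_mult X (x \<cdot>\<^bsub>X\<^esub> y)"
proof -
  define x' where "x' = inv_into (carrier X) (left_mult X) (left_mult X x)"
  define y' where "y' = inv_into (carrier X) (left_mult X) (left_mult X y)"
  have x': "x' \<in> carrier X" "left_mult X x' = left_mult X x"
    unfolding x'_def using x by (auto intro!: inv_into_into f_inv_into_f)
  have y': "y' \<in> carrier X" "left_mult X y' = left_mult X y"
    unfolding y'_def using y by (auto intro!: inv_into_into f_inv_into_f)
  have eq_x: "x' \<cdot>\<^bsub>X\<^esub> z = x \<cdot>\<^bsub>X\<^esub> z" and eq_y: "y' \<cdot>\<^bsub>X\<^esub> z = y \<cdot>\<^bsub>X\<^esub> z"
    if "z \<in> carrier X" for z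
    using fun_cong[OF x'(2), of z] fun_cong[OF y'(2), of z] that by (simp_all add: left_mult_def)
  have law: "(a \<cdot>\<^bsub>X\<^esub> b) \<cdot>\<^bsub>X\<^esub> (a \<cdot>\<^bsub>X\<^esub> c) = (b \<cdot>\<^bsub>X\<^esub> a) \<cdot>\<^bsub>X\<^esub> (b \<cdot>\<^bsub>X\<^esub> c)"
    if "a \<in> carrier X" "b \<in> carrier X" "c \<in> carrier X" for a b c
    using X that unfolding cycle_set_def by blast
  have surj: "left_mult X x ` carrier X = carrier X"
    using X x unfolding cycle_set_def bij_betw_def by blast
  have "left_mult X (x \<cdot>\<^bsub>X\<^esub> y') = left_mult X (x \<cdot>\<^bsub>X\<^esub> y)"
  proof
    fix w
    show "left_mult X (x \<cdot>\<^bsub>X\<^esub> y') w = left_mult X (x \<cdot>\<^bsub>X\<^esub> y) w"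
    proof (cases "w \<in> carrier X")
      case True
      then obtain z where z: "z \<in> carrier X" "w = left_mult X x z" using surj by blast
      then have w: "w = x \<cdot>\<^bsub>X\<^esub> z" by (simp add: left_mult_def)
      have "(x \<cdot>\<^bsub>X\<^esub> y') \<cdot>\<^bsub>X\<^esub> (x \<cdot>\<^bsub>X\<^esub> z) = (x \<cdot>\<^bsub>X\<^esub> y) \<cdot>\<^bsub>X\<^esub> (x \<cdot>\<^bsub>X\<^esub> z)"
        using law[OF x y'(1) z(1)] law[OF x y z(1)] eq_y[OF x] eq_y[OF z(1)] by simp
      then show ?thesis using True w by (simp add: left_mult_def)
    qed (simp add: left_mult_def)
  qed
  then show ?thesis
    using eq_x[OF y'(1)] by (simp add: retraction_def x'_def[symmetric] y'_def[symmetric])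
qed

lemma retraction_copy_iso:
  fixes X :: "'a cycle_struct"
  defines "h \<equiv> inv_into (carrier X) (left_mult X)"
  shows "bij_betw h (carrier (retraction X)) (carrier (retraction_copy X))"
    and "\<lbrakk>s \<in> carrier (retraction X); t \<in> carrier (retraction X)\<rbrakk> \<Longrightarrow>
           h (s \<cdot>\<^bsub>retraction X\<^esub> t) = h s \<cdot>\<^bsub>retraction_copy X\<^esub> h t"
proof -
  have copy: "retraction_copy X = transport h (retraction X)"
    by (simp add: retraction_copy_def h_def)
  have inj: "inj_on h (carrier (retraction X))"
    unfolding h_def retraction_def by (simp add: inj_on_inv_into)
  then show "bij_betw h (carrier (retraction X)) (carrier (retraction_copy X))"
    by (simp add: bij_betw_def copy transport_def)
  show "h (s \<cdot>\<^bsub>retraction X\<^esub> t) = h s \<cdot>\<^bsub>retraction_copy X\<^esub> h t"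
    if "s \<in> carrier (retraction X)" "t \<in> carrier (retraction X)"
    using that inj by (simp add: copy transport_def inv_into_f_f)
qed

end

theory Submission
  imports Defs "HOL-Algebra.Multiplicative_Group"
begin

text \<open>
  Write $q = p^k$. Since every $\sigma_i$ is a power of the cycle $t_1$, it is a translation
  $y \mapsto y + a(i)$ of $\mathbb{Z}/q$, with $a(i) = i \cdot 0$ and $a(0) = 1$. The whole theorem
  is about the single function $a$, for which the cycle set identity says that
  $a(i) + a(j + a(i))$ is symmetric in $i$ and $j$ modulo $q$.

  Every iterated retraction is again given by $a$: with $N_m = |\sigma^m(X)|$, the cycle set
  $\sigma^m(X)$ is $\mathbb{Z}/N_m$ with $i \cdot j = j + a(i)$. Passing to the next retraction
  identifies $i$ and $j$ exactly when $a(i) \equiv a(j)$ modulo $N_m$. This relation is stable under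
  translation, because the identity for $0$ and $i$ reads $1 + a(i + 1) \equiv a(i) + a(a(i))$ and
  so the class of $a(i + 1)$ depends only on that of $a(i)$. A translation-stable relation is
  congruence modulo some divisor of $N_m$, and that divisor is $N_{m+1}$
  (\<open>translation_presentation_retraction_copy\<close>). Hence $N_{m+1} \mid N_m$ and
  \[ a(i) \equiv a(j) \pmod{N_m} \iff i \equiv j \pmod{N_{m+1}}. \]

  The rest is arithmetic. As $N_n = 1$, all $a(i)$ are $1$ modulo $N_{n-1} > 1$, so $a(i) - 1 \ge 0$ has a
  mixed radix expansion with place values $N_{n-1}, \dots, N_1$; its digits are the $f_m(i)$. The
  digit at $N_m$ is read off from $a(i)$ modulo $N_{m-1}$, so it depends only on $i$ modulo $N_m$.
  The tail of the expansion starting at $N_b$ is $a(i) - 1$ modulo $N_{b-1}$, whence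
  $\varphi_b(i)$ is $a(i)$ reduced modulo $N_{b-1}$, and injectivity is the displayed equivalence.
  Finally $K_{j,i} \equiv j + a(i)$ modulo $N_1$, so $Q_{j,i} + 2 \equiv a(i) + a(j + a(i))$.
\<close>

section \<open>Translations of the integers modulo q\<close>

lemma std_cycle_in_Bij:
  assumes "0 < q"
  shows "std_cycle q \<in> Bij {0..q - 1}"
proof -
  have "inj_on (\<lambda>i. (i + 1) mod q) {0..q - 1}"
  proof (rule inj_onI)
    fix x y assume xy: "x \<in> {0..q - 1}" "y \<in> {0..q - 1}" "(x + 1) mod q = (y + 1) mod q"
    then have "[x = y] (mod q)"
      by (metis cong_add_rcancel_nat cong_def)
    then show "x = y"
      using xy(1,2) assms by (auto intro!: cong_less_modulus_unique_nat)
  qed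
  moreover have "(\<lambda>i. (i + 1) mod q) ` {0..q - 1} \<subseteq> {0..q - 1}"
    using assms by (auto simp: less_Suc_eq_le[symmetric])
  ultimately have "bij_betw (\<lambda>i. (i + 1) mod q) {0..q - 1} {0..q - 1}"
    by (simp add: bij_betw_def endo_inj_surj)
  then show ?thesis
    by (simp add: Bij_def std_cycle_def bij_betw_restrict_eq)
qed

lemma std_cycle_pow:
  assumes "0 < q"
  shows "std_cycle q [^]\<^bsub>BijGroup {0..q - 1}\<^esub> (e::nat) = (\<lambda>y\<in>{0..q - 1}. (y + e) mod q)"
proof -
  interpret group "BijGroup {0..q - 1}" by (rule group_BijGroup)
  show ?thesis
  proof (induction e)
    case 0
    show ?case
      using assms by (auto simp: BijGroup_def fun_eq_iff)
  next
    case (Suc e)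
    have Bij: "carrier (BijGroup {0..q - 1}) = Bij {0..q - 1}"
      by (simp add: BijGroup_def)
    have t: "std_cycle q \<in> Bij {0..q - 1}"
      by (rule std_cycle_in_Bij[OF assms])
    have "std_cycle q [^]\<^bsub>BijGroup {0..q - 1}\<^esub> Suc e =
        (\<lambda>y\<in>{0..q - 1}. (y + e) mod q) \<otimes>\<^bsub>BijGroup {0..q - 1}\<^esub> std_cycle q"
      by (simp only: nat_pow_Suc Suc.IH)
    also have "\<dots> = compose {0..q - 1} (\<lambda>y\<in>{0..q - 1}. (y + e) mod q) (std_cycle q)"
      using t nat_pow_closed[of "std_cycle q" e, unfolded Suc.IH Bij]
      by (simp add: BijGroup_def)
    also have "\<dots> = (\<lambda>y\<in>{0..q - 1}. (y + Suc e) mod q)"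
    proof
      fix y
      have "(y + 1) mod q \<in> {0..q - 1}"
        using assms by (simp add: less_Suc_eq_le[symmetric])
      then show "compose {0..q - 1} (\<lambda>y\<in>{0..q - 1}. (y + e) mod q) (std_cycle q) y =
          (\<lambda>y\<in>{0..q - 1}. (y + Suc e) mod q) y"
        by (simp add: compose_def std_cycle_def mod_simps)
    qed
    finally show ?case .
  qed
qed

lemma finite_Bij:
  assumes "finite S"
  shows "finite (Bij S)"
proof (rule finite_subset)
  show "Bij S \<subseteq> (\<Pi>\<^sub>E x\<in>S. S)"
    by (auto simp: Bij_def PiE_def dest: bij_betw_imp_funcset)
  show "finite (\<Pi>\<^sub>E x\<in>S. S)"
    using assms by (simp add: finite_PiE)
qed

lemma generate_std_cycle:
  assumes "0 < q"
  shows "generate (BijGroup {0..q - 1}) {std_cycle q} =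
    {std_cycle q [^]\<^bsub>BijGroup {0..q - 1}\<^esub> e | e. e \<in> (UNIV :: nat set)}"
proof -
  interpret group "BijGroup {0..q - 1}" by (rule group_BijGroup)
  show ?thesis
    by (rule generate_pow_on_finite_carrier)
       (use std_cycle_in_Bij[OF assms] in \<open>simp_all add: BijGroup_def finite_Bij\<close>)
qed

text \<open>The translation vector of $\sigma_x$ can be read off at the point $0$.\<close>

lemma left_mult_eq_std_cycle_pow:
  fixes X :: "nat cycle_struct"
  assumes q: "0 < q" and car: "carrier X = {0..q - 1}"
    and perm: "permutation_group X = generate (BijGroup (carrier X)) {std_cycle q}"
    and x: "x \<in> carrier X"
  shows "left_mult X x = std_cycle q [^]\<^bsub>BijGroup (carrier X)\<^esub> (left_mult X x 0)"
proof -
  have "left_mult X x \<in> generate (BijGroup (carrier X)) {std_cycle q}"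
    using x perm unfolding permutation_group_def by (metis generate.incl imageI)
  then obtain e :: nat where e: "left_mult X x = (\<lambda>y\<in>{0..q - 1}. (y + e) mod q)"
    unfolding car generate_std_cycle[OF q] using std_cycle_pow[OF q] by auto
  show ?thesis
    unfolding car std_cycle_pow[OF q] e by (auto simp: fun_eq_iff mod_simps)
qed

section \<open>Retractions of cycle sets acting by translations\<close>

text \<open>
  \<open>translation_presentation Y a N \<pi>\<close> identifies $Y$ with $\mathbb{Z}/N$, carrying the operation
  $i \cdot j = j + a(i)$. The naturals are used as unreduced representatives, so that the same $a$
  serves for every modulus. The last clause is the cycle set identity, with the common summand
  coming from the third argument cancelled.
\<close>

definition translation_presentation ::
    "'a cycle_struct \<Rightarrow> (nat \<Rightarrow> nat) \<Rightarrow> nat \<Rightarrow> (nat \<Rightarrow> 'a) \<Rightarrow> bool" where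
  "translation_presentation Y a N \<pi> \<longleftrightarrow>
     0 < N \<and> carrier Y = range \<pi> \<and>
     (\<forall>i j. \<pi> i = \<pi> j \<longleftrightarrow> [i = j] (mod N)) \<and>
     (\<forall>i j. \<pi> i \<cdot>\<^bsub>Y\<^esub> \<pi> j = \<pi> (j + a i)) \<and>
     [a 0 = 1] (mod N) \<and>
     (\<forall>i j. [a i + a (j + a i) = a j + a (i + a j)] (mod N))"

lemma translation_presentationD:
  assumes "translation_presentation Y a N \<pi>"
  shows "0 < N" "carrier Y = range \<pi>" "\<pi> i = \<pi> j \<longleftrightarrow> [i = j] (mod N)"
    "\<pi> i \<cdot>\<^bsub>Y\<^esub> \<pi> j = \<pi> (j + a i)" "[a 0 = 1] (mod N)"
    "[a i + a (j + a i) = a j + a (i + a j)] (mod N)"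
  using assms unfolding translation_presentation_def by blast+

lemma translation_presentation_carrier:
  assumes "translation_presentation Y a N \<pi>"
  shows "carrier Y = \<pi> ` {..<N}"
proof -
  note D = translation_presentationD[OF assms]
  have "\<pi> i \<in> \<pi> ` {..<N}" for i
    using D(1) D(3)[of i "i mod N"] by (auto simp: cong_def intro!: image_eqI[of _ _ "i mod N"])
  then show ?thesis
    unfolding D(2) by auto
qed

lemma translation_presentation_card:
  assumes "translation_presentation Y a N \<pi>"
  shows "card (carrier Y) = N"
proof -
  note D = translation_presentationD[OF assms]
  have "inj_on \<pi> {..<N}"
    by (auto simp: inj_on_def D(3) cong_less_modulus_unique_nat)
  then show ?thesis
    by (simp add: translation_presentation_carrier[OF assms] card_image)
qed

lemma translation_presentation_left_mult_eq_iff: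
  assumes "translation_presentation Y a N \<pi>"
  shows "left_mult Y (\<pi> i) = left_mult Y (\<pi> j) \<longleftrightarrow> [a i = a j] (mod N)"
proof -
  note D = translation_presentationD[OF assms]
  have "left_mult Y (\<pi> i) = left_mult Y (\<pi> j) \<longleftrightarrow> (\<forall>l. \<pi> i \<cdot>\<^bsub>Y\<^esub> \<pi> l = \<pi> j \<cdot>\<^bsub>Y\<^esub> \<pi> l)"
    by (auto simp: left_mult_def D(2) fun_eq_iff restrict_def)
  also have "\<dots> \<longleftrightarrow> [a i = a j] (mod N)"
    by (simp add: D(3,4) cong_add_lcancel_nat)
  finally show ?thesis .
qed

lemma translation_presentation_cycle_set:
  assumes "translation_presentation Y a N \<pi>"
  shows "cycle_set Y"
  unfolding cycle_set_def
proof (intro conjI ballI)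
  note D = translation_presentationD[OF assms]
  show "carrier Y \<noteq> {}"
    by (simp add: D(2))
  show "bij_betw (left_mult Y x) (carrier Y) (carrier Y)" if x: "x \<in> carrier Y" for x
  proof -
    obtain i where i: "x = \<pi> i" using x by (auto simp: D(2))
    have fin: "finite (carrier Y)"
      by (simp add: translation_presentation_carrier[OF assms])
    have "inj_on (left_mult Y x) (carrier Y)"
      by (rule inj_onI) (auto simp: D(2) i left_mult_def D(3,4) cong_add_rcancel_nat)
    moreover have "left_mult Y x ` carrier Y \<subseteq> carrier Y"
      by (auto simp: D(2) i left_mult_def D(4))
    ultimately show ?thesis
      using fin by (simp add: bij_betw_def endo_inj_surj)
  qed
  show "(x \<cdot>\<^bsub>Y\<^esub> y) \<cdot>\<^bsub>Y\<^esub> (x \<cdot>\<^bsub>Y\<^esub> z) = (y \<cdot>\<^bsub>Y\<^esub> x) \<cdot>\<^bsub>Y\<^esub> (y \<cdot>\<^bsub>Y\<^esub> z)"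
    if xyz: "x \<in> carrier Y" "y \<in> carrier Y" "z \<in> carrier Y" for x y z
  proof -
    obtain i j l where ijl: "x = \<pi> i" "y = \<pi> j" "z = \<pi> l"
      using xyz by (auto simp: D(2))
    have "[l + (a i + a (j + a i)) = l + (a j + a (i + a j))] (mod N)"
      using D(6) by (simp only: cong_add_lcancel_nat)
    then show ?thesis
      by (simp add: ijl D(3,4) add.assoc)
  qed
qed

text \<open>
  A translation-stable equivalence relation on the naturals, here the kernel of $c$, is congruence
  modulo the least positive $M$ with $c(M) = c(0)$: this $M$ is a period of $c$, and a coincidence
  $c(i) = c(j)$ with $i < j < M$, translated by $M - j$, would give $c(i + M - j) = c(0)$ and
  contradict minimality.
\<close>

lemma shift_stable_kernel_is_congruence:
  fixes c :: "nat \<Rightarrow> 'b"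
  assumes step: "\<And>i j. c i = c j \<Longrightarrow> c (Suc i) = c (Suc j)"
    and N: "0 < N" "c N = c 0"
  obtains M where "0 < M" "M dvd N" "\<And>i j. c i = c j \<longleftrightarrow> [i = j] (mod M)"
proof -
  define M where "M = (LEAST d. 0 < d \<and> c d = c 0)"
  have M: "0 < M" "c M = c 0"
    using LeastI[of "\<lambda>d. 0 < d \<and> c d = c 0" N] N unfolding M_def by auto
  have minimal: "M \<le> d" if "0 < d" "c d = c 0" for d
    unfolding M_def using that by (intro Least_le) simp
  have shift: "c (i + s) = c (j + s)" if "c i = c j" for i j s
  proof (induction s)
    case (Suc s)
    from step[OF this] show ?case by simp
  qed (use that in simp)
  have period: "c (i + s * M) = c i" for i s
  proof (induction s)
    case (Suc s)
    show ?case
      using shift[OF M(2), of "i + s * M"] Suc by (simp add: algebra_simps)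
  qed simp
  have reduce: "c (i mod M) = c i" for i
    using period[of "i mod M" "i div M"] by (simp add: add.commute)
  have distinct: "i = j" if "i \<le> j" "j < M" "c i = c j" for i j
  proof -
    have "c (i + (M - j)) = c 0"
      using shift[OF that(3), of "M - j"] that(2) M(2) by simp
    with minimal[of "i + (M - j)"] show ?thesis
      using that by simp
  qed
  have kernel: "c i = c j \<longleftrightarrow> [i = j] (mod M)" for i j
  proof
    assume "c i = c j"
    then have eq: "c (i mod M) = c (j mod M)"
      by (simp add: reduce)
    have "i mod M < M" "j mod M < M"
      using M(1) by simp_all
    then show "[i = j] (mod M)"
      using distinct[of "i mod M" "j mod M"] distinct[of "j mod M" "i mod M"] eq
      unfolding cong_def by (metis linear)
  next
    assume "[i = j] (mod M)"
    then show "c i = c j"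
      using reduce unfolding cong_def by metis
  qed
  have "M dvd N"
    using kernel[of N 0] N(2) by (simp add: cong_0_iff)
  with M(1) kernel show thesis
    using that by blast
qed

lemma translation_presentation_retraction_copy:
  assumes pres: "translation_presentation Y a N \<pi>"
  obtains M \<pi>' where "translation_presentation (retraction_copy Y) a M \<pi>'"
    "M dvd N" "\<And>i j. [a i = a j] (mod N) \<longleftrightarrow> [i = j] (mod M)"
proof -
  note D = translation_presentationD[OF pres]
  have welldef: "[a i = a j] (mod N)" if "[i = j] (mod N)" for i j
    using that D(3) translation_presentation_left_mult_eq_iff[OF pres] by metis
  have step: "[a (Suc i) = a (Suc j)] (mod N)" if ij: "[a i = a j] (mod N)" for i j
  proof -
    \<comment> \<open>The cycle set identity for \<open>0\<close> and \<open>i\<close>.\<close>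
    have rec: "[1 + a (Suc i) = a i + a (a i)] (mod N)" for i
    proof -
      have "[i + a 0 = Suc i] (mod N)"
        using cong_add[OF cong_refl[of i] D(5)] by simp
      then have "[1 + a (Suc i) = a 0 + a (i + a 0)] (mod N)"
        by (intro cong_add cong_sym[OF D(5)] cong_sym[OF welldef])
      also have "[a 0 + a (i + a 0) = a i + a (0 + a i)] (mod N)"
        by (rule D(6))
      finally show ?thesis by simp
    qed
    have "[a i + a (a i) = a j + a (a j)] (mod N)"
      using ij welldef by (intro cong_add)
    then have "[1 + a (Suc i) = 1 + a (Suc j)] (mod N)"
      using rec[of i] rec[of j] by (meson cong_sym cong_trans)
    then show ?thesis
      by (simp only: cong_add_lcancel_nat)
  qed
  have "a N mod N = a 0 mod N"
    using welldef[of N 0] by (simp add: cong_def)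
  then obtain M where M: "0 < M" "M dvd N"
    and "\<And>i j. a i mod N = a j mod N \<longleftrightarrow> [i = j] (mod M)"
    using shift_stable_kernel_is_congruence[of "\<lambda>i. a i mod N" N] step D(1)
    unfolding cong_def by metis
  then have kernel: "[a i = a j] (mod N) \<longleftrightarrow> [i = j] (mod M)" for i j
    by (simp add: cong_def)
  define h where "h = inv_into (carrier Y) (left_mult Y)"
  define \<pi>' where "\<pi>' i = h (left_mult Y (\<pi> i))" for i
  have retract: "left_mult Y (\<pi> i) \<in> carrier (retraction Y)" for i
    by (simp add: retraction_def D(2))
  have bij: "bij_betw h (carrier (retraction Y)) (carrier (retraction_copy Y))"
    unfolding h_def by (rule retraction_copy_iso)
  have "carrier (retraction_copy Y) = range \<pi>'"
    using bij by (auto simp: bij_betw_def \<pi>'_def retraction_def D(2))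
  moreover have "\<pi>' i = \<pi>' j \<longleftrightarrow> [i = j] (mod M)" for i j
    using inj_on_eq_iff[OF bij_betw_imp_inj_on[OF bij] retract retract]
    by (simp add: \<pi>'_def translation_presentation_left_mult_eq_iff[OF pres] kernel)
  moreover have "\<pi>' i \<cdot>\<^bsub>retraction_copy Y\<^esub> \<pi>' j = \<pi>' (j + a i)" for i j
  proof -
    have "\<pi>' i \<cdot>\<^bsub>retraction_copy Y\<^esub> \<pi>' j =
        h (left_mult Y (\<pi> i) \<cdot>\<^bsub>retraction Y\<^esub> left_mult Y (\<pi> j))"
      unfolding \<pi>'_def h_def by (rule retraction_copy_iso(2)[symmetric]) (rule retract)+
    also have "\<dots> = h (left_mult Y (\<pi> i \<cdot>\<^bsub>Y\<^esub> \<pi> j))"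
      by (subst dot_retraction) (auto simp: translation_presentation_cycle_set[OF pres] D(2))
    finally show ?thesis
      by (simp add: D(4) \<pi>'_def)
  qed
  ultimately have "translation_presentation (retraction_copy Y) a M \<pi>'"
    unfolding translation_presentation_def
    using M(1) cong_dvd_modulus_nat[OF D(5) M(2)] cong_dvd_modulus_nat[OF D(6) M(2)] by simp
  then show thesis
    using M(2) kernel by (rule that)
qed

lemma translation_presentation_iterated_retraction:
  assumes "translation_presentation X a N \<pi>"
  shows "\<exists>\<pi>'. translation_presentation (iterated_retraction m X) a (retraction_order X m) \<pi>'"
proof (induction m)
  case 0
  show ?case
    using assms translation_presentation_card[OF assms]
    by (auto simp: iterated_retraction_def retraction_order_def)
next
  case (Suc m)
  then obtain \<pi>' where
    "translation_presentation (iterated_retraction m X) a (retraction_order X m) \<pi>'" ..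
  then obtain M \<pi>'' where
    *: "translation_presentation (retraction_copy (iterated_retraction m X)) a M \<pi>''"
    by (rule translation_presentation_retraction_copy)
  have "iterated_retraction (Suc m) X = retraction_copy (iterated_retraction m X)"
    by (simp add: iterated_retraction_def)
  with * translation_presentation_card[OF *] show ?case
    by (auto simp: retraction_order_def)
qed

lemma translation_presentation_retraction_order:
  assumes "translation_presentation X a N \<pi>"
  shows "0 < retraction_order X m"
    and "retraction_order X (Suc m) dvd retraction_order X m"
    and "[a i = a j] (mod retraction_order X m) \<longleftrightarrow> [i = j] (mod retraction_order X (Suc m))"
proof -
  obtain \<pi>' where
    pres: "translation_presentation (iterated_retraction m X) a (retraction_order X m) \<pi>'"
    using translation_presentation_iterated_retraction[OF assms] by blast
  show "0 < retraction_order X m"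
    by (rule translation_presentationD[OF pres])
  obtain M \<pi>'' where
    pres': "translation_presentation (retraction_copy (iterated_retraction m X)) a M \<pi>''"
    and M: "M dvd retraction_order X m"
      "\<And>i j. [a i = a j] (mod retraction_order X m) \<longleftrightarrow> [i = j] (mod M)"
    using translation_presentation_retraction_copy[OF pres] by metis
  have "M = retraction_order X (Suc m)"
    using translation_presentation_card[OF pres']
    by (simp add: retraction_order_def iterated_retraction_def)
  with M show "retraction_order X (Suc m) dvd retraction_order X m"
    "[a i = a j] (mod retraction_order X m) \<longleftrightarrow> [i = j] (mod retraction_order X (Suc m))"
    by auto
qed

section \<open>Mixed radix expansion of the translation vectors\<close>

text \<open>The sum telescopes, since the summand at $m$ is $c \bmod N_{m-1} - c \bmod N_m$.\<close>

lemma mixed_radix_sum: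
  fixes N :: "nat \<Rightarrow> nat"
  assumes dvd: "\<And>m. N (Suc m) dvd N m" and b: "1 \<le> b" "b \<le> Suc e"
  shows "(\<Sum>m=b..e. N m * ((c mod N (m - 1)) div N m)) + c mod N e = c mod N (b - 1)"
  using b(2)
proof (induction e)
  case 0
  then show ?case using b(1) by (simp add: le_antisym)
next
  case (Suc e)
  have *: "N (Suc e) * ((c mod N e) div N (Suc e)) + c mod N (Suc e) = c mod N e"
    using mult_div_mod_eq[of "N (Suc e)" "c mod N e"] by (simp add: mod_mod_cancel[OF dvd])
  show ?case
  proof (cases "b \<le> Suc e")
    case False
    then have "b = Suc (Suc e)" using Suc.prems by simp
    then show ?thesis by simp
  qed (use Suc * in \<open>simp add: add.assoc\<close>)
qed

text \<open>
  The numbers $N_m$ stand for the orders of the iterated retractions, and the kernel of $a$ modulo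
  $N_m$ is where the retraction process enters. The telescoping sum gives
  $S_b(i) = (a(i) - 1) \bmod N_{b-1}$, from which the last three conclusions are read off.
\<close>

lemma mixed_radix_expansion:
  fixes N :: "nat \<Rightarrow> nat" and a :: "nat \<Rightarrow> nat" and n :: nat
  assumes pos: "\<And>m. 0 < N m" and dvd: "\<And>m. N (Suc m) dvd N m"
    and kernel: "\<And>m i j. [a i = a j] (mod N m) \<longleftrightarrow> [i = j] (mod N (Suc m))"
    and n: "1 < n" "N n = 1" "N (n - 1) \<noteq> 1"
    and a0: "a 0 = 1" and bound: "\<And>i. a i < N 0"
    and sym: "\<And>i j. [a i + a (j + a i) = a j + a (i + a j)] (mod N 0)"
  defines "f \<equiv> \<lambda>m l. ((a l - 1) mod N (m - 1)) div N m"
  defines "S \<equiv> \<lambda>b i. \<Sum>m=b..n-1. N m * f m (i mod N m)"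
  shows "\<And>j. 1 \<le> j \<Longrightarrow> f j \<in> {0..<N j} \<rightarrow> {0..<N (j - 1) div N j} \<and> f j 0 = 0"
    and "\<And>b. b \<in> {1..n-1} \<Longrightarrow> (\<lambda>i. 1 + S b i) \<in> {0..N b - 1} \<rightarrow> {1..N (b - 1) - 1} \<and>
           inj_on (\<lambda>i. 1 + S b i) {0..N b - 1}"
    and "\<And>i. 1 + S 1 i = a i"
    and "\<And>i j. [S 1 j + S 1 (i + 1 + S 2 j) = S 1 i + S 1 (j + 1 + S 2 i)] (mod N 0)"
proof -
  have base: "[a i = 1] (mod N (n - 1))" for i
    using kernel[of i 0 "n - 1"] n(1,2) a0 by simp
  have a_pos: "1 \<le> a i" for i
  proof (rule ccontr)
    assume "\<not> 1 \<le> a i"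
    then have "a i = 0" by simp
    with base[of i] have "[0 = 1] (mod N (n - 1))" by simp
    then show False using n(3) by (simp only: cong_0_1_nat)
  qed
  have base_dvd: "N (n - 1) dvd a i - 1" for i
    using base[of i] a_pos[of i] by (simp add: cong_altdef_nat)
  have digit: "f m (i mod N m) = f m i" if m: "1 \<le> m" for m i
  proof -
    have "[a (i mod N m) = a i] (mod N (m - 1))"
      using kernel[of "i mod N m" i "m - 1"] m by simp
    then have "[a (i mod N m) - 1 = a i - 1] (mod N (m - 1))"
      using a_pos by (intro cong_diff_nat) auto
    then show ?thesis
      by (simp add: f_def cong_def)
  qed
  have S: "S b i = (a i - 1) mod N (b - 1)" if b: "1 \<le> b" "b \<le> n" for b i
  proof -
    have "S b i = (\<Sum>m=b..n-1. N m * (((a i - 1) mod N (m - 1)) div N m))"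
      unfolding S_def using b digit by (intro sum.cong) (auto simp: f_def)
    then show ?thesis
      using mixed_radix_sum[of N b "n - 1" "a i - 1", OF dvd] b base_dvd[of i] by simp
  qed
  show "f j \<in> {0..<N j} \<rightarrow> {0..<N (j - 1) div N j} \<and> f j 0 = 0" if j: "1 \<le> j" for j
  proof -
    have "N (j - 1) = N j * (N (j - 1) div N j)"
      using dvd[of "j - 1"] j by simp
    then have "f j l < N (j - 1) div N j" for l
      unfolding f_def using pos[of "j - 1"]
      by (intro less_mult_imp_div_less) (metis mod_less_divisor mult.commute)
    then show ?thesis by (simp add: f_def a0)
  qed
  show S1: "1 + S 1 i = a i" for i
    using S[of 1 i] n(1) bound[of i] a_pos[of i] by simp
  have S_cong: "[1 + S b i = a i] (mod N (b - 1))" if b: "1 \<le> b" "b \<le> n" for b i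
  proof -
    have "[S b i = a i - 1] (mod N (b - 1))"
      unfolding S[OF b] by simp
    then have "[1 + S b i = 1 + (a i - 1)] (mod N (b - 1))"
      by (simp only: cong_add_lcancel_nat)
    then show ?thesis using a_pos[of i] by simp
  qed
  show "(\<lambda>i. 1 + S b i) \<in> {0..N b - 1} \<rightarrow> {1..N (b - 1) - 1} \<and>
      inj_on (\<lambda>i. 1 + S b i) {0..N b - 1}" if "b \<in> {1..n-1}" for b
  proof
    have b: "1 \<le> b" "b \<le> n" using that by auto
    have N_b: "N (n - 1) dvd N (b - 1)"
    proof -
      have "N m dvd N (b - 1)" if "b - 1 \<le> m" for m
        using that by (induction m rule: dec_induct) (auto intro: dvd_trans[OF dvd])
      moreover have "b - 1 \<le> n - 1"
        using b by simp
      ultimately show ?thesis .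
    qed
    have "1 + S b i < N (b - 1)" for i
    proof -
      \<comment> \<open>\<open>S b i\<close> and \<open>N (b - 1)\<close> are multiples of \<open>N (n - 1)\<close>,
        so they differ by at least 2.\<close>
      have "N (n - 1) dvd S b i"
        unfolding S[OF b] using base_dvd N_b by (simp add: dvd_mod)
      then have "N (n - 1) dvd N (b - 1) - S b i"
        using N_b by (simp add: dvd_diff_nat)
      moreover have "S b i < N (b - 1)"
        unfolding S[OF b] using pos by simp
      ultimately have "N (n - 1) \<le> N (b - 1) - S b i"
        by (simp add: dvd_imp_le)
      then show ?thesis
        using n(3) pos[of "n - 1"] by simp
    qed
    then show "(\<lambda>i. 1 + S b i) \<in> {0..N b - 1} \<rightarrow> {1..N (b - 1) - 1}"
      by (auto simp: Pi_iff intro: le_diff_conv2[THEN iffD2]) (metis Suc_leI Suc_pred less_Suc_eq_le pos)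
    show "inj_on (\<lambda>i. 1 + S b i) {0..N b - 1}"
    proof (rule inj_onI)
      fix i j assume ij: "i \<in> {0..N b - 1}" "j \<in> {0..N b - 1}" "1 + S b i = 1 + S b j"
      then have "[a i = a j] (mod N (b - 1))"
        using S_cong[OF b, of i] S_cong[OF b, of j] by (metis cong_sym cong_trans)
      then have "[i = j] (mod N b)"
        using kernel[of i j "b - 1"] b(1) by simp
      moreover have "i < N b" "j < N b"
        using ij(1,2) pos[of b] by auto
      ultimately show "i = j"
        by (rule cong_less_modulus_unique_nat)
    qed
  qed
  show "[S 1 j + S 1 (i + 1 + S 2 j) = S 1 i + S 1 (j + 1 + S 2 i)] (mod N 0)" for i j
  proof -
    have K: "[a (j + 1 + S 2 i) = a (j + a i)] (mod N 0)" for i j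
    proof -
      have "[j + (1 + S 2 i) = j + a i] (mod N 1)"
        using cong_add[OF cong_refl[of j] S_cong[of 2 i]] n(1) by simp
      then show ?thesis
        using kernel[of "j + 1 + S 2 i" "j + a i" 0] by (simp add: add.assoc)
    qed
    have Q: "[2 + (S 1 i + S 1 (j + 1 + S 2 i)) = a i + a (j + a i)] (mod N 0)" for i j
    proof -
      have "2 + (S 1 i + S 1 (j + 1 + S 2 i)) = a i + a (j + 1 + S 2 i)"
        using S1[of i] S1[of "j + 1 + S 2 i"] by simp
      then show ?thesis
        using K[of j i] by (simp only: cong_add_lcancel_nat)
    qed
    have "[2 + (S 1 j + S 1 (i + 1 + S 2 j)) = 2 + (S 1 i + S 1 (j + 1 + S 2 i))] (mod N 0)"
      using Q[of j i] Q[of i j] sym[of j i] by (meson cong_sym cong_trans)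
    then show ?thesis
      by (simp only: cong_add_lcancel_nat)
  qed
qed

section \<open>Cycle sets with a cyclic permutation group generated by the standard cycle\<close>

lemma translation_presentation_of_cyclic_cycle_set:
  fixes X :: "nat cycle_struct"
  assumes q: "1 < q" and car: "carrier X = {0..q - 1}" and X: "cycle_set X"
    and perm: "permutation_group X = generate (BijGroup (carrier X)) {std_cycle q}"
    and zero: "left_mult X 0 = std_cycle q"
  defines "a \<equiv> \<lambda>i. left_mult X (i mod q) 0"
  shows "translation_presentation X a q (\<lambda>i. i mod q)" and "a 0 = 1" and "a i < q"
    and "x \<in> carrier X \<Longrightarrow> left_mult X x = std_cycle q [^]\<^bsub>BijGroup (carrier X)\<^esub> a x"
proof -
  have mem: "i mod q \<in> carrier X" for i
    using q by (simp add: car less_Suc_eq_le[symmetric])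
  have car_less: "x \<in> carrier X \<longleftrightarrow> x < q" for x
    using q by (auto simp: car)
  show pow: "left_mult X x = std_cycle q [^]\<^bsub>BijGroup (carrier X)\<^esub> a x"
    if "x \<in> carrier X" for x
    using left_mult_eq_std_cycle_pow[OF _ car perm that] that q by (simp add: a_def car_less)
  have dot: "(i mod q) \<cdot>\<^bsub>X\<^esub> (j mod q) = (j + a i) mod q" for i j
  proof -
    have "a (i mod q) = a i"
      by (simp add: a_def)
    moreover have "left_mult X (i mod q) (j mod q) = (j mod q + a (i mod q)) mod q"
      unfolding pow[OF mem] car using std_cycle_pow[of q] q mem[of j] by (simp add: car)
    moreover have "left_mult X (i mod q) (j mod q) = (i mod q) \<cdot>\<^bsub>X\<^esub> (j mod q)"
      using mem[of j] by (simp add: left_mult_def)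
    ultimately show ?thesis
      by (simp only: mod_add_left_eq)
  qed
  show a0: "a 0 = 1"
    using q zero by (simp add: a_def std_cycle_def)
  show "a i < q" for i
  proof -
    have "left_mult X (i mod q) ` carrier X = carrier X"
      using X mem[of i] unfolding cycle_set_def bij_betw_def by blast
    moreover have "0 \<in> carrier X"
      by (simp add: car)
    ultimately have "left_mult X (i mod q) 0 \<in> carrier X"
      by blast
    then show ?thesis
      by (simp only: a_def car_less)
  qed
  have sym: "[a i + a (j + a i) = a j + a (i + a j)] (mod q)" for i j
  proof -
    have "((i mod q) \<cdot>\<^bsub>X\<^esub> (j mod q)) \<cdot>\<^bsub>X\<^esub> ((i mod q) \<cdot>\<^bsub>X\<^esub> (0 mod q)) =
        ((j mod q) \<cdot>\<^bsub>X\<^esub> (i mod q)) \<cdot>\<^bsub>X\<^esub> ((j mod q) \<cdot>\<^bsub>X\<^esub> (0 mod q))"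
      using X mem unfolding cycle_set_def by blast
    then show ?thesis
      unfolding dot by (simp add: cong_def)
  qed
  have "carrier X = range (\<lambda>i. i mod q)"
  proof
    show "carrier X \<subseteq> range (\<lambda>i. i mod q)"
      unfolding car_less subset_iff by (metis mod_less rangeI)
  qed (use mem in auto)
  then show "translation_presentation X a q (\<lambda>i. i mod q)"
    unfolding translation_presentation_def using q a0 sym dot by (simp add: cong_def)
qed

theorem theorem9:
  fixes X :: "nat cycle_struct" and p k n :: nat
  assumes "prime p"
    and "carrier X = {0..p ^ k - 1}"
    and "cycle_set X"
    and "indecomposable X"
    and "multipermutational_level X n"
    and "n > 1"
    and "permutation_group X = generate (BijGroup (carrier X)) {std_cycle (p ^ k)}"
    and "left_mult X 0 = std_cycle (p ^ k)"
  shows "\<exists>f :: nat \<Rightarrow> nat \<Rightarrow> nat.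
    let N = retraction_order X;
        F = (\<lambda>m l. f m (l mod N m));
        \<phi> = (\<lambda>b i. 1 + (\<Sum>m=b..n-1. N m * F m i));
        K = (\<lambda>j i. j + 1 + (\<Sum>m=2..n-1. N m * F m i));
        Q = (\<lambda>j i. (\<Sum>m=1..n-1. N m * F m i) + (\<Sum>m=1..n-1. N m * F m (K j i)))
    in (\<forall>j\<in>{1..n-1}. f j \<in> {0..<N j} \<rightarrow> {0..<N (j - 1) div N j} \<and> f j 0 = 0) \<and>
       (\<forall>b\<in>{1..n-1}. \<phi> b \<in> {0..N b - 1} \<rightarrow> {1..N (b - 1) - 1} \<and> inj_on (\<phi> b) {0..N b - 1}) \<and>
       (\<forall>i\<in>{0..p ^ k - 1}.
          left_mult X i =
            std_cycle (p ^ k) [^]\<^bsub>BijGroup (carrier X)\<^esub> (1 + (\<Sum>m=1..n-1. N m * F m i))) \<and>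
       (\<forall>i\<in>{0..p ^ k - 1}. \<forall>j\<in>{0..p ^ k - 1}. [Q i j = Q j i] (mod p ^ k))"
proof -
  define q where "q = p ^ k"
  define N where "N = retraction_order X"
  define a where "a i = left_mult X (i mod q) 0" for i
  have level: "N n = 1" "\<And>m. m < n \<Longrightarrow> N m \<noteq> 1"
    using assms(5) by (auto simp: multipermutational_level_def N_def)
  have q0: "0 < q"
    using assms(1) by (simp add: q_def prime_gt_0_nat)
  have N0: "N 0 = q"
    using q0 assms(2) by (simp add: N_def q_def retraction_order_def iterated_retraction_def)
  have q: "1 < q"
    using q0 N0 level(2)[of 0] assms(6) by simp
  note X = translation_presentation_of_cyclic_cycle_set[OF q assms(2)[folded q_def] assms(3)
      assms(7,8)[folded q_def], folded a_def]
  note order = translation_presentation_retraction_order[OF X(1), folded N_def]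
  note sym = translation_presentationD(6)[OF X(1), folded N0]
  have n1: "n - 1 < n"
    using assms(6) by simp
  note expansion = mixed_radix_expansion[of N a n, OF order assms(6) level(1) level(2)[OF n1] X(2)
      X(3)[folded N0] sym]
  define f where "f m l = ((a l - 1) mod N (m - 1)) div N m" for m l
  note expansion = expansion[folded f_def]
  show ?thesis
    unfolding Let_def N_def[symmetric] q_def[symmetric]
  proof (intro exI[of _ f] conjI)
    show "\<forall>j\<in>{1..n-1}. f j \<in> {0..<N j} \<rightarrow> {0..<N (j - 1) div N j} \<and> f j 0 = 0"
      using expansion(1) by (intro ballI) (simp only: atLeastAtMost_iff)
    show "\<forall>b\<in>{1..n-1}.
        (\<lambda>i. 1 + (\<Sum>m=b..n-1. N m * f m (i mod N m))) \<in> {0..N b - 1} \<rightarrow> {1..N (b - 1) - 1} \<and>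
        inj_on (\<lambda>i. 1 + (\<Sum>m=b..n-1. N m * f m (i mod N m))) {0..N b - 1}"
      using expansion(2) by (intro ballI)
    show "\<forall>i\<in>{0..q - 1}. left_mult X i = std_cycle q [^]\<^bsub>BijGroup (carrier X)\<^esub>
        (1 + (\<Sum>m=1..n-1. N m * f m (i mod N m)))"
      unfolding expansion(3) using X(4) assms(2) by (simp add: q_def)
  qed (use expansion(4) N0 in simp)
qed

end
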